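(* Let $\lambda$ be a nonzero real number. For every integer $n \geq 1$, the following identity holds (as polynomials in $x$ and $y$): \[ b_{n,\lambda}(x+y)-b_{n,\lambda}(x)=\sum_{k=1}^n \sum_{m=1}^k \sum_{l=1}^m \sum_{j=1}^l \frac{\binom{m+1}{l}\binom{n}{k}\binom{l}{j-1}}{m+1}\, \lambda^{k-m}\,S_1(k,m)\,b_{n-k,\lambda}\,y^{l+1-j}\,B_{j-1}(x). \]
   Context: For a nonzero real $\lambda$, the degenerate ordered Bell polynomials $b_{n,\lambda}(x)$ are defined by the formal power series identity \[ \frac{1}{2-(1+\lambda t)^{1/\lambda}}(1+\lambda t)^{x/\lambda}=\sum_{n=0}^\infty b_{n,\lambda}(x)\frac{t^n}{n!}, \] where $(1+\lambda t)^{a/\lambda}=\exp\big(\tfrac{a}{\lambda}\log(1+\lambda t)\big)$. The degenerate ordered Bell numbers are $b_{n,\lambda}=b_{n,\lambda}(0)$. The (signed) Stirling numbers of the first kind $S_1(n,l)$ are defined by $(x)_n=x(x-1)\cdots(x-n+1)=\sum_{l=0}^n S_1(n,l)x^l$. The Bernoulli polynomials $B_n(x)$ are defined by $\frac{t}{e^t-1}e^{xt}=\sum_{n\ge 0}B_n(x)\frac{t^n}{n!}$. *)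

theory Defs
  imports "HOL-Computational_Algebra.Computational_Algebra"
begin

unbundle fps_syntax

(* log (1 + lam t); note that fps_ln 1 is the series of log (1 + t). *)
definition fps_log1p :: "real \<Rightarrow> real fps" where
  "fps_log1p lam = fps_ln 1 oo (fps_const lam * fps_X)"

(* (1 + lam t)^(a/lam) for a real number a. *)
definition degen_exp :: "real \<Rightarrow> real \<Rightarrow> real fps" where
  "degen_exp lam a = fps_exp 1 oo (fps_const (a / lam) * fps_log1p lam)"

(* The inclusion of R[[t]] into R[x][[t]]. *)
definition fps_lift :: "real fps \<Rightarrow> real poly fps" where
  "fps_lift F = Abs_fps (\<lambda>n. [:F $ n:])"

(* e^(x t) as a power series in t over R[x].  The library's fps_exp needs a coefficient field. *)
definition fps_exp_x :: "real poly fps" where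
  "fps_exp_x = Abs_fps (\<lambda>n. monom (1 / fact n) n)"

(* (1 + lam t)^(x/lam) = exp (x * (log (1 + lam t) / lam)) as a power series in t over R[x]. *)
definition degen_exp_x :: "real \<Rightarrow> real poly fps" where
  "degen_exp_x lam = fps_exp_x oo fps_lift (fps_const (1 / lam) * fps_log1p lam)"

(* b_{n,lam}(x) as an element of R[x].  The inverse is taken in R[[t]], where the series
   2 - (1 + lam t)^(1/lam) has constant term 1. *)
definition degen_bell_poly :: "real \<Rightarrow> nat \<Rightarrow> real poly" where
  "degen_bell_poly lam n =
     smult (fact n) ((fps_lift (inverse (2 - degen_exp lam 1)) * degen_exp_x lam) $ n)"

definition degen_bell :: "real \<Rightarrow> nat \<Rightarrow> real" where
  "degen_bell lam n = poly (degen_bell_poly lam n) 0"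

(* Division in R[[t]] cancels the common factor t, so t / (e^t - 1) is the usual unit series. *)
definition bernoulli_poly :: "nat \<Rightarrow> real poly" where
  "bernoulli_poly n =
     smult (fact n) ((fps_lift (fps_X / (fps_exp 1 - 1)) * fps_exp_x) $ n)"

(* Signed Stirling numbers of the first kind; the library's stirling is the unsigned version. *)
definition stirling1 :: "nat \<Rightarrow> nat \<Rightarrow> real" where
  "stirling1 n l = coeff (\<Prod>i<n. [:- real i, 1:]) l"

(* R[x,y] is rendered as R[x][y], i.e. as real poly poly: the outer indeterminate is y. *)
definition const_xy :: "real \<Rightarrow> real poly poly" where
  "const_xy c = [:[:c:]:]"

definition var_x :: "real poly poly" where
  "var_x = [:[:0, 1:]:]"

definition var_y :: "real poly poly" where
  "var_y = [:0, 1:]"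

(* p(q) in R[x,y], for p a univariate real polynomial and q in R[x,y]. *)
definition subst_xy :: "real poly \<Rightarrow> real poly poly \<Rightarrow> real poly poly" where
  "subst_xy p q = poly (map_poly const_xy p) q"

(* Evaluating at a real number recovers the generating functions over the reals. *)

lemma fps_lift_power_nth: "(fps_lift F ^ i) $ n = [: (F^i) $ n :]"
proof (induction i arbitrary: n)
  case 0 show ?case by (cases n) (auto simp: one_pCons)
next
  case (Suc i) 
  have s: "(\<Sum>i\<in>A. [:f i:]) = [:\<Sum>i\<in>A. f i:]" for A and f::"nat\<Rightarrow>real" by (induction A rule: infinite_finite_induct) auto
  show ?case by (simp add: fps_mult_nth Suc s) (simp add: fps_lift_def Suc[unfolded fps_lift_def] s mult_ac)
qed

lemma poly_degen_exp_x_nth: "poly (degen_exp_x l $ n) a = degen_exp l a $ n"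
proof -
  have "degen_exp l a = fps_exp 1 oo (fps_const a * (fps_const (1/l) * fps_log1p l))"
    unfolding degen_exp_def mult.assoc[symmetric] by simp
  then show ?thesis unfolding degen_exp_x_def
  by (simp add: fps_compose_nth poly_sum fps_lift_power_nth fps_exp_x_def poly_monom power_mult_distrib fps_const_power fps_exp_def mult_ac del: fps_const_mult)
qed

lemma poly_degen_bell_poly:
  "poly (degen_bell_poly l n) a = fact n * ((1/(2 - degen_exp l 1)) * degen_exp l a) $ n"
  unfolding degen_bell_poly_def by (simp add: fps_mult_nth poly_sum poly_degen_exp_x_nth fps_lift_def fps_divide_unit degen_exp_def)

lemma poly_bernoulli_poly:
  "poly (bernoulli_poly n) a = fact n * ((fps_X / (fps_exp 1 - 1)) * fps_exp a) $ n"
  unfolding bernoulli_poly_def by (simp add: fps_mult_nth poly_sum fps_lift_def fps_exp_x_def fps_exp_def poly_monom)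

end

theory Submission
  imports Defs
begin

(* In the generating function of b_n(x+y) - b_n(x) only the factor (1 + lam t)^(x/lam) depends on
   the argument, and its k-th coefficient is the sum over m of lam^(k-m) S1(k,m) x^m / k!.
   It remains to expand (x+y)^m - x^m in Bernoulli polynomials, which follows from
   (m+1) z^m = sum_{l \<le> m} C(m+1,l) B_l(z) together with the addition formula for B_l(x+y).
   Since R is infinite, the polynomial identity may be checked at real points (x,y). *)

text \<open>By the chain rule the composite F satisfies F' = c F / (1 + X), and its constant term is
  1; these two conditions characterise the binomial series.\<close>

lemma fps_exp_compose_ln: "fps_exp c oo fps_ln 1 = (fps_binomial c :: 'a :: field_char_0 fps)"
proof -
  have "fps_deriv (fps_exp c oo fps_ln 1) = fps_const c * (fps_exp c oo fps_ln 1) / (1 + fps_X)"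
    by (simp add: fps_compose_deriv fps_ln_deriv fps_compose_mult_distrib fps_divide_unit mult_ac)
  then show ?thesis
    by (simp add: fps_binomial_ODE_unique'[symmetric])
qed

lemma degen_exp_eq_binomial: "degen_exp lam a = fps_binomial (a / lam) oo (fps_const lam * fps_X)"
proof -
  have "degen_exp lam a = (fps_exp 1 oo (fps_const (a / lam) * fps_X)) oo fps_log1p lam"
    unfolding degen_exp_def
    by (subst fps_compose_assoc[symmetric]) (simp_all add: fps_log1p_def fps_compose_mult_distrib)
  also have "\<dots> = (fps_exp (a / lam) oo fps_ln 1) oo (fps_const lam * fps_X)"
    unfolding fps_log1p_def by (subst fps_compose_assoc[symmetric]) simp_all
  finally show ?thesis
    by (simp only: fps_exp_compose_ln)
qed

lemma sum_stirling1: "(\<Sum>m\<le>k. stirling1 k m * z ^ m) = (\<Prod>i<k. z - real i)"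
proof -
  let ?p = "\<Prod>i<k. [:- real i, 1:]"
  have "degree ?p \<le> k"
    by (rule order.trans[OF degree_prod_sum_le]) simp_all
  then have "poly ?p z = (\<Sum>m\<le>k. coeff ?p m * z ^ m)"
    unfolding poly_altdef by (intro sum.mono_neutral_left) (auto simp: coeff_eq_0)
  then show ?thesis
    by (simp add: stirling1_def poly_prod)
qed

text \<open>k! times the generalised binomial coefficient of \<open>a / lam\<close> is a falling
  factorial, which Stirling numbers expand in powers of \<open>a / lam\<close>; the factor
  \<open>lam ^ k\<close> absorbs the denominators because m \<le> k.\<close>

lemma degen_exp_nth:
  assumes "lam \<noteq> 0"
  shows "fact k * degen_exp lam a $ k = (\<Sum>m\<le>k. lam ^ (k - m) * stirling1 k m * a ^ m)"
proof -
  have "fact k * degen_exp lam a $ k = lam ^ k * (\<Sum>m\<le>k. stirling1 k m * (a / lam) ^ m)"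
    by (simp add: degen_exp_eq_binomial gbinomial_prod_rev sum_stirling1 atLeast0LessThan)
  also have "\<dots> = (\<Sum>m\<le>k. lam ^ (k - m) * stirling1 k m * a ^ m)"
    unfolding sum_distrib_left
    by (rule sum.cong) (use assms in \<open>simp_all add: power_diff power_divide\<close>)
  finally show ?thesis .
qed

text \<open>Multiplying exponential generating functions is binomial convolution of their
  sequences.\<close>

lemma fact_mult_fps_mult_nth:
  fixes F G :: "real fps"
  shows "fact n * (F * G) $ n =
    (\<Sum>k\<le>n. real (n choose k) * (fact k * F $ k) * (fact (n - k) * G $ (n - k)))"
  unfolding fps_mult_nth sum_distrib_left atLeast0AtMost
  by (rule sum.cong) (simp_all add: binomial_fact)

lemma poly_degen_bell_poly_expand:
  "poly (degen_bell_poly lam n) a =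
    (\<Sum>k\<le>n. real (n choose k) * (fact k * degen_exp lam a $ k) * degen_bell lam (n - k))"
proof -
  \<comment> \<open>Hence the Bell numbers are generated by the reciprocal factor alone.\<close>
  have "degen_exp lam 0 = 1"
    by (simp add: degen_exp_eq_binomial)
  then have "degen_bell lam j = fact j * (1 / (2 - degen_exp lam 1)) $ j" for j
    by (simp add: degen_bell_def poly_degen_bell_poly)
  then show ?thesis
    unfolding poly_degen_bell_poly mult.commute[of "1 / _"] fact_mult_fps_mult_nth by simp
qed

text \<open>Binomial convolution applied to e^((x+y)t) = e^(xt) e^(yt).\<close>

lemma bernoulli_poly_add:
  "poly (bernoulli_poly l) (x + y) =
    (\<Sum>i\<le>l. real (l choose i) * y ^ (l - i) * poly (bernoulli_poly i) x)"
  unfolding poly_bernoulli_poly fps_exp_add_mult mult.assoc[symmetric]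
  by (subst fact_mult_fps_mult_nth) (simp add: mult_ac)

text \<open>Compare the coefficients of t^(m+1) in (t / (e^t - 1)) e^(zt) (e^t - 1) = t
  e^(zt).\<close>

lemma sum_bernoulli_poly:
  "(\<Sum>l\<le>m. real (Suc m choose l) * poly (bernoulli_poly l) z) = real (Suc m) * z ^ m"
proof -
  define E :: "real fps" where "E = fps_exp 1 - 1"
  define T where "T = fps_X / E"
  \<comment> \<open>This makes \<open>E\<close> divide \<open>fps_X\<close>, so the quotient
    \<open>T\<close> is exact.\<close>
  have "subdegree E = 1"
    by (rule subdegreeI) (auto simp: E_def)
  moreover from this have "E \<noteq> 0"
    by auto
  ultimately have "T * E = fps_X"
    unfolding T_def by (intro dvd_div_mult_self) (simp add: fps_dvd_iff)
  then have "(T * fps_exp z) * E = fps_X * fps_exp z"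
    by (metis mult.assoc mult.commute)
  then have "fact (Suc m) * ((T * fps_exp z) * E) $ Suc m = fact (Suc m) * (fps_X * fps_exp z) $ Suc m"
    by (simp only:)
  moreover have "fact (Suc m) * (fps_X * fps_exp z) $ Suc m = real (Suc m) * z ^ m"
    by simp
  moreover have "fact (Suc m) * ((T * fps_exp z) * E) $ Suc m =
      (\<Sum>l\<le>m. real (Suc m choose l) * poly (bernoulli_poly l) z)"
    \<comment> \<open>The top index \<open>Suc m\<close> drops out because \<open>E\<close> has
      constant term 0; its other coefficients are 1 / j!.\<close>
    unfolding fact_mult_fps_mult_nth sum.atMost_Suc poly_bernoulli_poly T_def
    by (auto simp: E_def intro!: sum.cong)
  ultimately show ?thesis
    by (simp only:)
qed

lemma power_diff_bernoulli_poly: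
  fixes x y :: real
  shows "(x + y) ^ m - x ^ m = (\<Sum>l=1..m. \<Sum>j=1..l.
    real ((m + 1) choose l) * real (l choose (j - 1)) / real (m + 1) *
      y ^ (l + 1 - j) * poly (bernoulli_poly (j - 1)) x)"
proof -
  let ?B = "\<lambda>l. poly (bernoulli_poly l)"
  have add: "?B l (x + y) - ?B l x =
      (\<Sum>j=1..l. real (l choose (j - 1)) * y ^ (l + 1 - j) * ?B (j - 1) x)" for l
  proof -
    have "?B l (x + y) - ?B l x = (\<Sum>i<l. real (l choose i) * y ^ (l - i) * ?B i x)"
      \<comment> \<open>The summand i = l is exactly \<open>?B l x\<close> and cancels.\<close>
      by (simp add: bernoulli_poly_add flip: lessThan_Suc_atMost)
    also have "\<dots> = (\<Sum>j=1..l. real (l choose (j - 1)) * y ^ (l + 1 - j) * ?B (j - 1) x)"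
      by (rule sum.reindex_bij_witness[of _ "\<lambda>j. j - 1" Suc]) auto
    finally show ?thesis .
  qed
  have "real (m + 1) * ((x + y) ^ m - x ^ m) =
      (\<Sum>l\<le>m. real (Suc m choose l) * (?B l (x + y) - ?B l x))"
    by (simp add: right_diff_distrib sum_subtractf sum_bernoulli_poly del: binomial_Suc_Suc)
  also have "\<dots> = (\<Sum>l=1..m. real (Suc m choose l) * (?B l (x + y) - ?B l x))"
    \<comment> \<open>The summand l = 0 vanishes: by \<open>add\<close> its difference is an empty
      sum.\<close>
    by (rule sum.mono_neutral_right) (auto simp: add not_le)
  finally have "(x + y) ^ m - x ^ m =
      (\<Sum>l=1..m. real (Suc m choose l) * (?B l (x + y) - ?B l x)) / real (m + 1)"
    by (simp add: field_simps)
  then show ?thesis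
    by (simp add: add sum_divide_distrib sum_distrib_left mult_ac del: binomial_Suc_Suc)
qed

lemma poly_subst_xy: "poly (poly (subst_xy p q) [:y:]) x = poly p (poly (poly q [:y:]) x)"
  by (induction p) (simp_all add: subst_xy_def const_xy_def map_poly_pCons)

text \<open>For each real y, agreement at all real x gives equality in R[x]. So p - q, as a
  polynomial in the outer variable, has infinitely many roots \<open>[:y:]\<close> in the integral
  domain R[x].\<close>

lemma poly_poly_eqI:
  fixes p q :: "real poly poly"
  assumes "\<And>x y. poly (poly p [:y:]) x = poly (poly q [:y:]) x"
  shows "p = q"
proof -
  have "infinite (range (\<lambda>y::real. [:y:]))"
    by (auto simp: finite_image_iff inj_on_def infinite_UNIV_char_0)
  moreover have "range (\<lambda>y. [:y:]) \<subseteq> {z. poly (p - q) z = 0}"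
    using assms by (auto simp: poly_eq_poly_eq_iff[symmetric])
  ultimately have "p - q = 0"
    using poly_roots_finite finite_subset by blast
  then show ?thesis
    by simp
qed

theorem theorem1:
  fixes lam :: real and n :: nat
  assumes "lam \<noteq> 0" and "n \<ge> 1"
  shows "subst_xy (degen_bell_poly lam n) (var_x + var_y) - subst_xy (degen_bell_poly lam n) var_x =
    (\<Sum>k=1..n. \<Sum>m=1..k. \<Sum>l=1..m. \<Sum>j=1..l.
       const_xy (real ((m + 1) choose l) * real (n choose k) * real (l choose (j - 1)) / real (m + 1)
                 * lam ^ (k - m) * stirling1 k m * degen_bell lam (n - k))
       * var_y ^ (l + 1 - j) * subst_xy (bernoulli_poly (j - 1)) var_x)"
    (is "?lhs = ?rhs")
proof (rule poly_poly_eqI)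
  fix x y :: real
  let ?b = "poly (degen_bell_poly lam n)"
  let ?e = "\<lambda>a k. fact k * degen_exp lam a $ k"
  let ?s = "\<lambda>k m. lam ^ (k - m) * stirling1 k m * ((x + y) ^ m - x ^ m)"
  have e: "?e (x + y) k - ?e x k = (\<Sum>m=1..k. ?s k m)" for k
  proof -
    have "?e (x + y) k - ?e x k = (\<Sum>m\<le>k. ?s k m)"
      by (simp add: degen_exp_nth[OF assms(1)] sum_subtractf right_diff_distrib)
    also have "\<dots> = (\<Sum>m=1..k. ?s k m)"
      by (rule sum.mono_neutral_right) (auto simp: not_le)
    finally show ?thesis .
  qed
  have "poly (poly ?lhs [:y:]) x = ?b (x + y) - ?b x"
    by (simp add: poly_subst_xy var_x_def var_y_def add.commute)
  also have "\<dots> = (\<Sum>k\<le>n. real (n choose k) * (?e (x + y) k - ?e x k) * degen_bell lam (n - k))"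
    by (simp add: poly_degen_bell_poly_expand sum_subtractf left_diff_distrib right_diff_distrib)
  also have "\<dots> = (\<Sum>k=1..n. real (n choose k) * (\<Sum>m=1..k. ?s k m) * degen_bell lam (n - k))"
    \<comment> \<open>At k = 0 the inner sum is empty.\<close>
    unfolding e by (rule sum.mono_neutral_right) (auto simp: not_le)
  also have "\<dots> = poly (poly ?rhs [:y:]) x"
    unfolding power_diff_bernoulli_poly
    by (simp add: poly_sum poly_subst_xy var_x_def var_y_def const_xy_def sum_distrib_left
        sum_distrib_right poly_power mult_ac del: binomial_Suc_Suc)
  finally show "poly (poly ?lhs [:y:]) x = poly (poly ?rhs [:y:]) x" .
qed

end
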